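(* For $n\ge r\ge1$, the map $\rho:\mathrm{SP}(n,r)\to\mathrm{AS}(n,r)\times S_r$ is a bijection, and if $\rho(\nu)=(\tau,\sigma)$ then $\mathrm{cro}(\nu)=\mathrm{cro}(\tau)+\mathrm{inv}(\sigma)$.
   Context: A signed permutation of $[n]$ is a bijection $\tau$ of $[n]\cup(-[n])$ with $\tau(-i)=-\tau(i)$; $\mathrm{neg}(\tau)=\{i\in[n]:\tau(i)<0\}$. $\mathrm{SP}(n,r)$ is the set of signed permutations with $|\mathrm{neg}(\tau)|=r$ and $1\in\mathrm{neg}(\tau)$; $\mathrm{AS}(n,r)$ is the set of $\tau\in\mathrm{SP}(n,r)$ such that, with $\mathrm{neg}(\tau)=\{d_1<\cdots<d_r\}$, $|\tau(d_1)|<\cdots<|\tau(d_r)|$. $S_r$ is the symmetric group and $\mathrm{inv}(\sigma)$ the number of inversions of $\sigma$. The map $\rho$: for $\nu\in\mathrm{SP}(n,r)$ let $a_1<\cdots<a_r$ be the elements of $\mathrm{neg}(\nu)$ and $b_1<\cdots<b_r$ the elements of $\{|\nu(a_1)|,\dots,|\nu(a_r)|\}$; let $\sigma\in S_r$ be the unique permutation with $\nu(a_j)=-b_{\sigma(j)}$ for all $j$; define $\tau$ by $\tau(a_j)=-b_j$ for $j\in[r]$ and $\tau(i)=\nu(i)$ for $i\notin\mathrm{neg}(\nu)$ (extended by $\tau(-i)=-\tau(i)$); set $\rho(\nu)=(\tau,\sigma)$. Crossings. For a signed permutation $\tau$, define a total order $<_\tau$ on $\mathrm{neg}(\tau)$: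 $i<_\tau j$ iff $\min(i,|\tau(i)|)<\min(j,|\tau(j)|)$, or $\min(i,|\tau(i)|)=i=|\tau(j)|=\min(j,|\tau(j)|)$. Write $\mathrm{neg}(\tau)=\{e_1<_\tau\cdots<_\tau e_r\}$. The arc diagram has points $-r<\cdots<-1<1<\cdots<n$ and, for each $i\in[n]$: if $\tau(i)\ge i$ an upper arc $(i,\tau(i))$; if $0<\tau(i)<i$ a lower arc $(\tau(i),i)$; if $i=e_j$ a lower arc $(-j,i)$ and an upper arc $(-j,|\tau(i)|)$. An upper crossing is a pair of upper arcs $(a,b),(c,d)$ with $a<c\le b<d$; a lower crossing a pair of lower arcs $(a,b),(c,d)$ with $a<c<b<d$; $\mathrm{cro}(\tau)$ is the total number of crossings. *)

theory Defs
  imports "HOL-Combinatorics.Permutations"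
begin

text \<open>
  Following the library's \<open>permutes\<close> convention, a signed permutation of \<open>[n]\<close> is a total
  function on the integers that is the identity outside \<open>[n] \<union> -[n]\<close> (so that equality of
  functions is equality of signed permutations).
\<close>

definition signed_perm :: "nat \<Rightarrow> (int \<Rightarrow> int) \<Rightarrow> bool" where
  "signed_perm n \<tau> \<longleftrightarrow> \<tau> permutes ({1..int n} \<union> uminus ` {1..int n}) \<and> (\<forall>i. \<tau> (- i) = - \<tau> i)"

definition neg :: "nat \<Rightarrow> (int \<Rightarrow> int) \<Rightarrow> int set" where
  "neg n \<tau> = {i \<in> {1..int n}. \<tau> i < 0}"

definition SP :: "nat \<Rightarrow> nat \<Rightarrow> (int \<Rightarrow> int) set" where
  "SP n r = {\<tau>. signed_perm n \<tau> \<and> card (neg n \<tau>) = r \<and> 1 \<in> neg n \<tau>}"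

definition AS :: "nat \<Rightarrow> nat \<Rightarrow> (int \<Rightarrow> int) set" where
  "AS n r = {\<tau> \<in> SP n r. sorted_wrt (<) (map (\<lambda>d. \<bar>\<tau> d\<bar>) (sorted_list_of_set (neg n \<tau>)))}"

definition Sym :: "nat \<Rightarrow> (nat \<Rightarrow> nat) set" where
  "Sym r = {\<sigma>. \<sigma> permutes {1..r}}"

definition inversions :: "nat \<Rightarrow> (nat \<Rightarrow> nat) \<Rightarrow> nat" where
  "inversions r \<sigma> = card {(i, j). i \<in> {1..r} \<and> j \<in> {1..r} \<and> i < j \<and> \<sigma> i > \<sigma> j}"


text \<open>The \<open>j\<close>-th smallest element of a finite set, counting from 1.\<close>

definition nth_smallest :: "int set \<Rightarrow> nat \<Rightarrow> int" where
  "nth_smallest A j = sorted_list_of_set A ! (j - 1)"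

definition neg_elem :: "nat \<Rightarrow> (int \<Rightarrow> int) \<Rightarrow> nat \<Rightarrow> int" where  \<comment> \<open>\<open>a\<^sub>j\<close>\<close>
  "neg_elem n \<nu> j = nth_smallest (neg n \<nu>) j"

definition neg_value :: "nat \<Rightarrow> (int \<Rightarrow> int) \<Rightarrow> nat \<Rightarrow> int" where  \<comment> \<open>\<open>b\<^sub>j\<close>\<close>
  "neg_value n \<nu> j = nth_smallest ((\<lambda>a. \<bar>\<nu> a\<bar>) ` neg n \<nu>) j"

definition rho_sigma :: "nat \<Rightarrow> nat \<Rightarrow> (int \<Rightarrow> int) \<Rightarrow> nat \<Rightarrow> nat" where
  "rho_sigma n r \<nu> =
    (THE \<sigma>. \<sigma> \<in> Sym r \<and> (\<forall>j\<in>{1..r}. \<nu> (neg_elem n \<nu> j) = - neg_value n \<nu> (\<sigma> j)))"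

definition neg_index :: "nat \<Rightarrow> nat \<Rightarrow> (int \<Rightarrow> int) \<Rightarrow> int \<Rightarrow> nat" where
  "neg_index n r \<nu> x = (THE j. j \<in> {1..r} \<and> neg_elem n \<nu> j = x)"

text \<open>
  The second branch is the extension \<open>\<tau> (-i) = - \<tau> i\<close>; in the last branch the
  extension agrees with \<open>\<nu>\<close> because \<open>\<nu>\<close> itself is odd.
\<close>

definition rho_tau :: "nat \<Rightarrow> nat \<Rightarrow> (int \<Rightarrow> int) \<Rightarrow> int \<Rightarrow> int" where
  "rho_tau n r \<nu> x =
    (if x \<in> neg n \<nu> then - neg_value n \<nu> (neg_index n r \<nu> x)
     else if - x \<in> neg n \<nu> then neg_value n \<nu> (neg_index n r \<nu> (- x))
     else \<nu> x)"

definition rho :: "nat \<Rightarrow> nat \<Rightarrow> (int \<Rightarrow> int) \<Rightarrow> (int \<Rightarrow> int) \<times> (nat \<Rightarrow> nat)" where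
  "rho n r \<nu> = (rho_tau n r \<nu>, rho_sigma n r \<nu>)"


text \<open>
  The strict order \<open><\<^sub>\<tau>\<close> on \<open>neg \<tau>\<close>. The conjunct \<open>i \<noteq> j\<close> is
  needed for strictness: when \<open>\<tau> i = - i\<close>, the second alternative holds for \<open>j = i\<close>.
\<close>

definition neg_less :: "(int \<Rightarrow> int) \<Rightarrow> int \<Rightarrow> int \<Rightarrow> bool" where
  "neg_less \<tau> i j \<longleftrightarrow> i \<noteq> j \<and>
    (min i \<bar>\<tau> i\<bar> < min j \<bar>\<tau> j\<bar> \<or>
     min i \<bar>\<tau> i\<bar> = i \<and> i = \<bar>\<tau> j\<bar> \<and> \<bar>\<tau> j\<bar> = min j \<bar>\<tau> j\<bar>)"

definition neg_list :: "nat \<Rightarrow> (int \<Rightarrow> int) \<Rightarrow> int list" where  \<comment> \<open>\<open>[e\<^sub>1, \<dots>, e\<^sub>r]\<close>\<close>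
  "neg_list n \<tau> = (THE es. set es = neg n \<tau> \<and> sorted_wrt (neg_less \<tau>) es)"

definition neg_nth :: "nat \<Rightarrow> (int \<Rightarrow> int) \<Rightarrow> nat \<Rightarrow> int" where  \<comment> \<open>\<open>e\<^sub>j\<close>\<close>
  "neg_nth n \<tau> j = neg_list n \<tau> ! (j - 1)"

text \<open>
  An arc is the pair of its left and right endpoint. Distinct indices give distinct arcs of the
  same kind, so sets of arcs lose no multiplicities.
\<close>

definition upper_arcs :: "nat \<Rightarrow> (int \<Rightarrow> int) \<Rightarrow> (int \<times> int) set" where
  "upper_arcs n \<tau> =
    {(i, \<tau> i) | i. i \<in> {1..int n} \<and> \<tau> i \<ge> i} \<union>
    {(- int j, \<bar>\<tau> (neg_nth n \<tau> j)\<bar>) | j. j \<in> {1..card (neg n \<tau>)}}"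

definition lower_arcs :: "nat \<Rightarrow> (int \<Rightarrow> int) \<Rightarrow> (int \<times> int) set" where
  "lower_arcs n \<tau> =
    {(\<tau> i, i) | i. i \<in> {1..int n} \<and> 0 < \<tau> i \<and> \<tau> i < i} \<union>
    {(- int j, neg_nth n \<tau> j) | j. j \<in> {1..card (neg n \<tau>)}}"

definition upper_crossings :: "nat \<Rightarrow> (int \<Rightarrow> int) \<Rightarrow> ((int \<times> int) \<times> (int \<times> int)) set" where
  "upper_crossings n \<tau> =
    {((a, b), (c, d)). (a, b) \<in> upper_arcs n \<tau> \<and> (c, d) \<in> upper_arcs n \<tau> \<and> a < c \<and> c \<le> b \<and> b < d}"

definition lower_crossings :: "nat \<Rightarrow> (int \<Rightarrow> int) \<Rightarrow> ((int \<times> int) \<times> (int \<times> int)) set" where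
  "lower_crossings n \<tau> =
    {((a, b), (c, d)). (a, b) \<in> lower_arcs n \<tau> \<and> (c, d) \<in> lower_arcs n \<tau> \<and> a < c \<and> c < b \<and> b < d}"

definition cro :: "nat \<Rightarrow> (int \<Rightarrow> int) \<Rightarrow> nat" where
  "cro n \<tau> = card (upper_crossings n \<tau>) + card (lower_crossings n \<tau>)"

end

theory Submission
  imports Defs
begin

text \<open>The inverse of \<open>\<rho>\<close> sends \<open>(\<tau>, \<sigma>)\<close> to \<open>\<tau> \<circ> \<pi>\<close>, where \<open>\<pi>\<close> is the odd permutation that
  moves the \<open>j\<close>-th element of \<open>neg \<tau>\<close> to the \<open>\<sigma>(j)\<close>-th one. Crossings with at least one arc not
  coming from \<open>neg \<nu>\<close> depend only on the sets \<open>neg \<nu>\<close> and \<open>\<bar>\<nu>\<bar>(neg \<nu>)\<close> and on the values of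
  \<open>\<nu>\<close> outside \<open>neg \<nu>\<close>, so \<open>\<rho>\<close> preserves them. The remaining crossings correspond
  one-to-one to the pairs \<open>x < y\<close> in \<open>neg \<nu>\<close> with \<open>\<bar>\<nu>(x)\<bar> > \<bar>\<nu>(y)\<bar>\<close>, that is, to the
  inversions of \<open>\<sigma>\<close>; for \<open>\<tau>\<close> there are none.\<close>

subsection \<open>Enumerating a finite set of integers\<close>

lemma nth_smallest_less:
  assumes "finite A" "i \<in> {1..card A}" "j \<in> {1..card A}" "i < j"
  shows "nth_smallest A i < nth_smallest A j"
  using assms strict_sorted_list_of_set[of A]
  unfolding nth_smallest_def sorted_wrt_iff_nth_less by auto

lemma nth_smallest_less_iff:
  assumes "finite A" "i \<in> {1..card A}" "j \<in> {1..card A}"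
  shows "nth_smallest A i < nth_smallest A j \<longleftrightarrow> i < j"
  using nth_smallest_less[OF assms] nth_smallest_less[OF assms(1,3,2)]
  by (metis linorder_neqE_nat order_less_asym)

lemma nth_bij_betw:
  assumes "distinct xs"
  shows "bij_betw (\<lambda>j. xs ! (j - 1)) {1..length xs} (set xs)"
proof -
  have "bij_betw (\<lambda>j. j - 1) {1..length xs} {..<length xs}"
    by (rule bij_betw_byWitness[where f' = Suc]) auto
  from bij_betw_trans[OF this bij_betw_nth[OF assms refl refl]]
  show ?thesis by (simp add: comp_def)
qed

lemma bij_betw_nth_smallest:
  assumes "finite A"
  shows "bij_betw (nth_smallest A) {1..card A} A"
  using nth_bij_betw[of "sorted_list_of_set A"] assms
  unfolding nth_smallest_def by simp

subsection \<open>Signed permutations\<close>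

lemma neg_subset: "neg n \<tau> \<subseteq> {1..int n}"
  unfolding neg_def by auto

lemma finite_neg [simp]: "finite (neg n \<tau>)"
  by (rule finite_subset[OF neg_subset]) simp

lemma signed_perm_minus: "signed_perm n \<tau> \<Longrightarrow> \<tau> (- x) = - \<tau> x"
  unfolding signed_perm_def by blast

lemma signed_perm_eq_iff: "signed_perm n \<tau> \<Longrightarrow> \<tau> x = \<tau> y \<longleftrightarrow> x = y"
  unfolding signed_perm_def by (metis permutes_inj injD)

lemma signed_perm_comp:
  assumes "signed_perm n \<tau>" "signed_perm n \<pi>"
  shows "signed_perm n (\<tau> \<circ> \<pi>)"
  using assms unfolding signed_perm_def by (auto intro: permutes_compose)

text \<open>All values on \<open>neg n \<tau>\<close> are negative, so
  \<open>\<bar>\<tau> x\<bar>\<close> is \<open>- \<tau> x\<close> there and injectivity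
  survives.\<close>

lemma signed_perm_inj_abs: "signed_perm n \<tau> \<Longrightarrow> inj_on (\<lambda>x. \<bar>\<tau> x\<bar>) (neg n \<tau>)"
  unfolding neg_def by (rule inj_onI) (auto simp: signed_perm_eq_iff)

subsection \<open>Permuting the negative positions\<close>

text \<open>The odd extension of \<open>p\<close>. For \<open>A\<close> inside
  \<open>{1..int n}\<close>, no \<open>x\<close> has both \<open>x\<close> and \<open>- x\<close> in
  \<open>A\<close>, so the order of the first two branches is immaterial.\<close>

definition signed_lift :: "int set \<Rightarrow> (int \<Rightarrow> int) \<Rightarrow> int \<Rightarrow> int" where
  "signed_lift A p x = (if x \<in> A then p x else if - x \<in> A then - p (- x) else x)"

text \<open>Applied to \<open>p\<close> and \<open>inv p\<close> in both orders, this gives the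
  two-sided inverse from which bijectivity of a lift follows.\<close>

lemma signed_lift_comp:
  assumes "A \<subseteq> {1..int n}" "p permutes A" "q permutes A" "p \<circ> q = id"
  shows "signed_lift A p \<circ> signed_lift A q = id"
proof
  fix x
  have pos: "- y \<notin> A" if "y \<in> A" for y
    using subsetD[OF assms(1) that] subsetD[OF assms(1), of "- y"] by auto
  have pq: "p (q y) = y" for y using assms(4) by (metis comp_apply id_apply)
  have q: "q y \<in> A" if "y \<in> A" for y using that permutes_in_image[OF assms(3)] by blast
  consider "x \<in> A" | "x \<notin> A" "- x \<in> A" | "x \<notin> A" "- x \<notin> A" by blast
  then show "(signed_lift A p \<circ> signed_lift A q) x = id x"
  proof cases
    case 2
    then show ?thesis using q[of "- x"] pos[of "q (- x)"] by (simp add: signed_lift_def pq)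
  qed (use q in \<open>simp_all add: signed_lift_def pq\<close>)
qed

lemma signed_perm_lift:
  assumes "A \<subseteq> {1..int n}" "p permutes A"
  shows "signed_perm n (signed_lift A p)"
proof -
  have inv: "inv p permutes A" using assms(2) by (rule permutes_inv)
  have "bij (signed_lift A p)"
    by (rule o_bij[where g = "signed_lift A (inv p)"])
       (simp_all add: signed_lift_comp[OF assms(1)] assms(2) inv permutes_inv_o[OF assms(2)])
  moreover have "signed_lift A p x = x" if "x \<notin> {1..int n} \<union> uminus ` {1..int n}" for x
  proof -
    have "- x \<notin> A"
    proof
      assume "- x \<in> A"
      then have "- (- x) \<in> uminus ` {1..int n}" using assms(1) by (intro imageI) auto
      then show False using that by simp
    qed
    then show ?thesis using that assms(1) by (auto simp: signed_lift_def)
  qed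
  ultimately have "signed_lift A p permutes ({1..int n} \<union> uminus ` {1..int n})"
    by (simp add: permutes_def bij_iff)
  moreover have "signed_lift A p (- x) = - signed_lift A p x" for x
  proof -
    have "\<not> (x \<in> A \<and> - x \<in> A)"
      using subsetD[OF assms(1), of x] subsetD[OF assms(1), of "- x"] by auto
    then show ?thesis by (auto simp: signed_lift_def)
  qed
  ultimately show ?thesis unfolding signed_perm_def by blast
qed

text \<open>Composing \<open>\<tau>\<close> with this map for \<open>A = neg n \<tau>\<close> will
  invert \<open>\<rho>\<close>. \<open>inv_into\<close> recovers the rank of \<open>x\<close> in
  \<open>A\<close>; the inner \<open>if\<close> makes the argument of \<open>signed_lift\<close> a
  permutation of \<open>A\<close> in the sense of \<open>permutes\<close>, as
  \<open>signed_perm_lift\<close> requires.\<close>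

definition permute_set :: "int set \<Rightarrow> (nat \<Rightarrow> nat) \<Rightarrow> int \<Rightarrow> int" where
  "permute_set A \<sigma> = signed_lift A (\<lambda>x. if x \<in> A
     then nth_smallest A (\<sigma> (inv_into {1..card A} (nth_smallest A) x)) else x)"

lemma
  assumes "A \<subseteq> {1..int n}" "\<sigma> \<in> Sym (card A)"
  shows signed_perm_permute_set: "signed_perm n (permute_set A \<sigma>)"
    and permute_set_nth: "j \<in> {1..card A} \<Longrightarrow>
      permute_set A \<sigma> (nth_smallest A j) = nth_smallest A (\<sigma> j)"
    and permute_set_other: "x \<notin> A \<Longrightarrow> - x \<notin> A \<Longrightarrow> permute_set A \<sigma> x = x"
    and permute_set_image: "permute_set A \<sigma> ` A = A"
proof -
  have fin: "finite A" using assms(1) finite_subset by blast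
  note bij = bij_betw_nth_smallest[OF fin]
  have sig: "\<sigma> permutes {1..card A}" using assms(2) by (simp add: Sym_def)
  have perm: "(\<lambda>x. if x \<in> A then nth_smallest A (\<sigma> (inv_into {1..card A} (nth_smallest A) x)) else x)
    permutes A"
    using permutes_bij_inv_into[OF sig bij] by simp
  show "signed_perm n (permute_set A \<sigma>)"
    unfolding permute_set_def by (rule signed_perm_lift[OF assms(1) perm])
  show "permute_set A \<sigma> (nth_smallest A j) = nth_smallest A (\<sigma> j)" if "j \<in> {1..card A}"
    using that bij by (simp add: permute_set_def signed_lift_def bij_betw_apply
      bij_betw_inv_into_left)
  show "x \<notin> A \<Longrightarrow> - x \<notin> A \<Longrightarrow> permute_set A \<sigma> x = x"
    by (simp add: permute_set_def signed_lift_def)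
  have "permute_set A \<sigma> ` A =
    (\<lambda>x. if x \<in> A then nth_smallest A (\<sigma> (inv_into {1..card A} (nth_smallest A) x)) else x) ` A"
    by (rule image_cong) (simp_all add: permute_set_def signed_lift_def)
  then show "permute_set A \<sigma> ` A = A" using permutes_image[OF perm] by simp
qed

text \<open>Negative positions move among themselves and every other positive position is fixed, so
  the sign at each position of \<open>[n]\<close> stays the same.\<close>

lemma neg_comp_permute_set:
  assumes "signed_perm n \<tau>" "\<sigma> \<in> Sym (card (neg n \<tau>))"
  shows "neg n (\<tau> \<circ> permute_set (neg n \<tau>) \<sigma>) = neg n \<tau>"
proof -
  let ?A = "neg n \<tau>"
  have "x \<in> neg n (\<tau> \<circ> permute_set ?A \<sigma>) \<longleftrightarrow> x \<in> ?A" for x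
  proof (cases "x \<in> ?A")
    case True
    then have "permute_set ?A \<sigma> x \<in> ?A"
      using permute_set_image[OF neg_subset assms(2)] by blast
    then show ?thesis using True by (auto simp: neg_def)
  next
    case False
    show ?thesis
    proof (cases "x \<in> {1..int n}")
      case True
      then have "- x \<notin> ?A" using neg_subset[of n \<tau>] by fastforce
      then show ?thesis using permute_set_other[OF neg_subset assms(2) False] False
        by (auto simp: neg_def)
    qed (auto simp: neg_def)
  qed
  then show ?thesis by blast
qed

lemma eq_on_signed_perm:
  assumes "signed_perm n \<mu>" "signed_perm n \<nu>"
    and "\<And>j. j \<in> {1..card A} \<Longrightarrow> \<mu> (nth_smallest A j) = \<nu> (nth_smallest A j)"
    and "finite A" "\<And>x. x \<notin> A \<Longrightarrow> - x \<notin> A \<Longrightarrow> \<mu> x = \<nu> x"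
  shows "\<mu> = \<nu>"
proof
  have A: "\<mu> x = \<nu> x" if "x \<in> A" for x
    using that assms(3) bij_betw_nth_smallest[OF assms(4)]
    unfolding bij_betw_def by (metis imageE)
  fix x
  show "\<mu> x = \<nu> x"
    using A[of x] A[of "- x"] assms(5)[of x]
      signed_perm_minus[OF assms(1), of x] signed_perm_minus[OF assms(2), of x]
    by (cases "x \<in> A"; cases "- x \<in> A") simp_all
qed

subsection \<open>The map \<open>\<rho>\<close> is a bijection\<close>

lemma
  assumes "signed_perm n \<nu>"
  shows bij_betw_neg_elem: "bij_betw (neg_elem n \<nu>) {1..card (neg n \<nu>)} (neg n \<nu>)"
    and bij_betw_neg_value: "bij_betw (neg_value n \<nu>) {1..card (neg n \<nu>)} ((\<lambda>a. \<bar>\<nu> a\<bar>) ` neg n \<nu>)"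
    and neg_elem_less_iff: "\<lbrakk>i \<in> {1..card (neg n \<nu>)}; j \<in> {1..card (neg n \<nu>)}\<rbrakk> \<Longrightarrow>
      neg_elem n \<nu> i < neg_elem n \<nu> j \<longleftrightarrow> i < j"
    and neg_value_less_iff: "\<lbrakk>i \<in> {1..card (neg n \<nu>)}; j \<in> {1..card (neg n \<nu>)}\<rbrakk> \<Longrightarrow>
      neg_value n \<nu> i < neg_value n \<nu> j \<longleftrightarrow> i < j"
proof -
  have c: "card ((\<lambda>a. \<bar>\<nu> a\<bar>) ` neg n \<nu>) = card (neg n \<nu>)"
    using signed_perm_inj_abs[OF assms] by (rule card_image)
  show "bij_betw (neg_elem n \<nu>) {1..card (neg n \<nu>)} (neg n \<nu>)"
    using bij_betw_nth_smallest[of "neg n \<nu>"] by (simp add: neg_elem_def[abs_def])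
  show "bij_betw (neg_value n \<nu>) {1..card (neg n \<nu>)} ((\<lambda>a. \<bar>\<nu> a\<bar>) ` neg n \<nu>)"
    using bij_betw_nth_smallest[of "(\<lambda>a. \<bar>\<nu> a\<bar>) ` neg n \<nu>"] c by (simp add: neg_value_def[abs_def])
  show "neg_elem n \<nu> i < neg_elem n \<nu> j \<longleftrightarrow> i < j"
    if "i \<in> {1..card (neg n \<nu>)}" "j \<in> {1..card (neg n \<nu>)}"
    unfolding neg_elem_def using that by (simp add: nth_smallest_less_iff)
  show "neg_value n \<nu> i < neg_value n \<nu> j \<longleftrightarrow> i < j"
    if "i \<in> {1..card (neg n \<nu>)}" "j \<in> {1..card (neg n \<nu>)}"
    unfolding neg_value_def using that c by (simp add: nth_smallest_less_iff)
qed

text \<open>Existence: send \<open>j\<close> to the rank of \<open>\<bar>\<nu> a\<bar>\<close> among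
  the \<open>neg_value\<close>s, where \<open>a\<close> is the \<open>j\<close>-th negative
  position. Uniqueness: \<open>neg_value\<close> is injective on \<open>{1..r}\<close>. This
  justifies the description in \<open>rho_sigma\<close>.\<close>

lemma rho_sigma_unique:
  assumes "signed_perm n \<nu>" "card (neg n \<nu>) = r"
  shows "\<exists>!\<sigma>. \<sigma> \<in> Sym r \<and> (\<forall>j\<in>{1..r}. \<nu> (neg_elem n \<nu> j) = - neg_value n \<nu> (\<sigma> j))"
proof (rule ex_ex1I)
  let ?I = "{1..r}" and ?A = "neg n \<nu>"
  let ?B = "(\<lambda>a. \<bar>\<nu> a\<bar>) ` ?A"
  note a = bij_betw_neg_elem[OF assms(1), unfolded assms(2)]
  note b = bij_betw_neg_value[OF assms(1), unfolded assms(2)]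
  define f where "f = inv_into ?I (neg_value n \<nu>) \<circ> ((\<lambda>a. \<bar>\<nu> a\<bar>) \<circ> neg_elem n \<nu>)"
  have abs: "bij_betw (\<lambda>a. \<bar>\<nu> a\<bar>) ?A ?B"
    using signed_perm_inj_abs[OF assms(1)] by (simp add: bij_betw_def)
  have f: "bij_betw f ?I ?I"
    unfolding f_def by (rule bij_betw_trans[OF bij_betw_trans[OF a abs] bij_betw_inv_into[OF b]])
  \<comment> \<open>Elements of \<open>Sym r\<close> are total functions fixing everything outside
    \<open>{1..r}\<close>, where \<open>f\<close> is uncontrolled.\<close>
  define \<sigma> where "\<sigma> j = (if j \<in> ?I then f j else j)" for j
  have "bij_betw \<sigma> ?I ?I"
    using f by (rule bij_betw_cong[THEN iffD1, rotated]) (simp add: \<sigma>_def)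
  then have "\<sigma> permutes ?I" by (rule bij_imp_permutes) (auto simp: \<sigma>_def)
  moreover have "\<nu> (neg_elem n \<nu> j) = - neg_value n \<nu> (\<sigma> j)" if "j \<in> ?I" for j
  proof -
    have "neg_elem n \<nu> j \<in> ?A" using a that by (rule bij_betw_apply)
    then have "\<bar>\<nu> (neg_elem n \<nu> j)\<bar> \<in> ?B" "\<nu> (neg_elem n \<nu> j) < 0" by (auto simp: neg_def)
    then show ?thesis using bij_betw_inv_into_right[OF b] that by (simp add: \<sigma>_def f_def)
  qed
  ultimately show "\<exists>\<sigma>. \<sigma> \<in> Sym r \<and> (\<forall>j\<in>?I. \<nu> (neg_elem n \<nu> j) = - neg_value n \<nu> (\<sigma> j))"
    by (auto simp: Sym_def)
next
  let ?I = "{1..r}"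
  note b = bij_betw_neg_value[OF assms(1), unfolded assms(2)]
  fix \<sigma> \<sigma>'
  assume s: "\<sigma> \<in> Sym r \<and> (\<forall>j\<in>?I. \<nu> (neg_elem n \<nu> j) = - neg_value n \<nu> (\<sigma> j))"
    and s': "\<sigma>' \<in> Sym r \<and> (\<forall>j\<in>?I. \<nu> (neg_elem n \<nu> j) = - neg_value n \<nu> (\<sigma>' j))"
  have p: "\<sigma> permutes ?I" "\<sigma>' permutes ?I" using s s' by (simp_all add: Sym_def)
  show "\<sigma> = \<sigma>'"
  proof
    fix j
    show "\<sigma> j = \<sigma>' j"
    proof (cases "j \<in> ?I")
      case True
      then have "neg_value n \<nu> (\<sigma> j) = neg_value n \<nu> (\<sigma>' j)" using s s' by force
      moreover have "\<sigma> j \<in> ?I" "\<sigma>' j \<in> ?I"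
        using True permutes_in_image[OF p(1)] permutes_in_image[OF p(2)] by blast+
      ultimately show ?thesis using b by (auto simp: bij_betw_def dest: inj_onD)
    next
      case False
      then show ?thesis using p by (simp add: permutes_not_in)
    qed
  qed
qed

lemma
  assumes "signed_perm n \<nu>" "card (neg n \<nu>) = r"
  shows rho_sigma_in_Sym: "rho_sigma n r \<nu> \<in> Sym r"
    and apply_neg_elem: "j \<in> {1..r} \<Longrightarrow> \<nu> (neg_elem n \<nu> j) = - neg_value n \<nu> (rho_sigma n r \<nu> j)"
  using theI'[OF rho_sigma_unique[OF assms]] unfolding rho_sigma_def by blast+

lemma rho_sigma_eqI:
  assumes "signed_perm n \<nu>" "card (neg n \<nu>) = r" "\<sigma> \<in> Sym r"
    and "\<And>j. j \<in> {1..r} \<Longrightarrow> \<nu> (neg_elem n \<nu> j) = - neg_value n \<nu> (\<sigma> j)"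
  shows "rho_sigma n r \<nu> = \<sigma>"
  unfolding rho_sigma_def
  by (rule the1_equality[OF rho_sigma_unique[OF assms(1,2)]]) (use assms(3,4) in blast)

section \<open>The first component of \<rho>\<close>

lemma rho_tau_neg_elem:
  assumes "signed_perm n \<nu>" "card (neg n \<nu>) = r" "j \<in> {1..r}"
  shows "rho_tau n r \<nu> (neg_elem n \<nu> j) = - neg_value n \<nu> j"
proof -
  note a = bij_betw_neg_elem[OF assms(1), unfolded assms(2)]
  have "neg_index n r \<nu> (neg_elem n \<nu> j) = j"
    unfolding neg_index_def
    by (rule the_equality) (use a assms(3) in \<open>auto simp: bij_betw_def dest: inj_onD\<close>)
  then show ?thesis using bij_betw_apply[OF a assms(3)] by (simp add: rho_tau_def)
qed

lemma rho_tau_minus: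
  assumes "signed_perm n \<nu>"
  shows "rho_tau n r \<nu> (- x) = - rho_tau n r \<nu> x"
proof -
  have "\<not> (x \<in> neg n \<nu> \<and> - x \<in> neg n \<nu>)" unfolding neg_def by auto
  then show ?thesis using signed_perm_minus[OF assms] by (auto simp: rho_tau_def)
qed

lemma rho_tau_eqI:
  assumes "signed_perm n \<nu>" "card (neg n \<nu>) = r" "signed_perm n \<tau>"
    and nth: "\<And>j. j \<in> {1..r} \<Longrightarrow> \<tau> (neg_elem n \<nu> j) = - neg_value n \<nu> j"
    and other: "\<And>x. x \<notin> neg n \<nu> \<Longrightarrow> - x \<notin> neg n \<nu> \<Longrightarrow> \<tau> x = \<nu> x"
  shows "rho_tau n r \<nu> = \<tau>"
proof
  note a = bij_betw_neg_elem[OF assms(1), unfolded assms(2)]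
  have A: "rho_tau n r \<nu> x = \<tau> x" if "x \<in> neg n \<nu>" for x
  proof -
    have "x \<in> neg_elem n \<nu> ` {1..r}" using that bij_betw_imp_surj_on[OF a] by simp
    then obtain j where "j \<in> {1..r}" "x = neg_elem n \<nu> j" by blast
    then show ?thesis using nth rho_tau_neg_elem[OF assms(1,2)] by simp
  qed
  fix x
  show "rho_tau n r \<nu> x = \<tau> x"
  proof (cases "x \<in> neg n \<nu> \<or> - x \<in> neg n \<nu>")
    case True
    then show ?thesis
      using A[of x] A[of "- x"] signed_perm_minus[OF assms(3), of x] rho_tau_minus[OF assms(1), of r x]
      by auto
  next
    case False
    then show ?thesis using other by (simp add: rho_tau_def)
  qed
qed

text \<open>With a, b as in the definition of \<rho> and \<sigma> =
  \<open>rho_sigma n r \<nu>\<close>, \<nu> sends the element a with index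
  \<open>inv \<sigma> j\<close> to minus the b with index
  \<open>\<sigma> (inv \<sigma> j) = j\<close>. In this form, \<open>rho_tau\<close> inherits all
  that is known about compositions with \<open>permute_set\<close>.\<close>

lemma rho_tau_eq_comp:
  assumes "signed_perm n \<nu>" "card (neg n \<nu>) = r"
  shows "rho_tau n r \<nu> = \<nu> \<circ> permute_set (neg n \<nu>) (inv (rho_sigma n r \<nu>))"
proof (rule rho_tau_eqI[OF assms])
  let ?\<sigma> = "rho_sigma n r \<nu>"
  have p: "?\<sigma> permutes {1..r}"
    using rho_sigma_in_Sym[OF assms] by (simp add: Sym_def)
  then have p': "inv ?\<sigma> permutes {1..r}" by (rule permutes_inv)
  then have i: "inv ?\<sigma> \<in> Sym (card (neg n \<nu>))" using assms(2) by (simp add: Sym_def)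
  show "signed_perm n (\<nu> \<circ> permute_set (neg n \<nu>) (inv ?\<sigma>))"
    using signed_perm_comp[OF assms(1) signed_perm_permute_set[OF neg_subset i]] .
  show "(\<nu> \<circ> permute_set (neg n \<nu>) (inv ?\<sigma>)) (neg_elem n \<nu> j) = - neg_value n \<nu> j"
    if "j \<in> {1..r}" for j
  proof -
    have "inv ?\<sigma> j \<in> {1..r}" using that permutes_in_image[OF p'] by blast
    then show ?thesis
      using permute_set_nth[OF neg_subset i] that assms(2) apply_neg_elem[OF assms]
        permutes_inverses(1)[OF p]
      by (simp add: neg_elem_def)
  qed
  show "(\<nu> \<circ> permute_set (neg n \<nu>) (inv ?\<sigma>)) x = \<nu> x"
    if "x \<notin> neg n \<nu>" "- x \<notin> neg n \<nu>" for x
    using permute_set_other[OF neg_subset i that] by simp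
qed

section \<open>Invariants of the composition and the inverse of \<rho>\<close>

lemma abs_image_comp_permute_set:
  assumes "\<sigma> \<in> Sym (card (neg n \<tau>))"
  shows "(\<lambda>a. \<bar>(\<tau> \<circ> permute_set (neg n \<tau>) \<sigma>) a\<bar>) ` neg n \<tau> = (\<lambda>a. \<bar>\<tau> a\<bar>) ` neg n \<tau>"
proof -
  have "(\<lambda>a. \<bar>(\<tau> \<circ> permute_set (neg n \<tau>) \<sigma>) a\<bar>) ` neg n \<tau> =
    (\<lambda>a. \<bar>\<tau> a\<bar>) ` permute_set (neg n \<tau>) \<sigma> ` neg n \<tau>" by (simp add: image_image)
  then show ?thesis by (simp only: permute_set_image[OF neg_subset assms])
qed

text \<open>Both enumerations depend only on the set of negative positions and the set of their
  absolute values, and the composition preserves these two sets.\<close>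

lemma neg_elem_value_comp:
  assumes "signed_perm n \<tau>" "\<sigma> \<in> Sym (card (neg n \<tau>))"
  shows "neg_elem n (\<tau> \<circ> permute_set (neg n \<tau>) \<sigma>) = neg_elem n \<tau>"
    and "neg_value n (\<tau> \<circ> permute_set (neg n \<tau>) \<sigma>) = neg_value n \<tau>"
  unfolding neg_elem_def[abs_def] neg_value_def[abs_def] neg_comp_permute_set[OF assms]
    abs_image_comp_permute_set[OF assms(2)] by (rule refl)+

lemma SP_comp_permute_set:
  assumes "\<tau> \<in> SP n r" "\<sigma> \<in> Sym r"
  shows "\<tau> \<circ> permute_set (neg n \<tau>) \<sigma> \<in> SP n r"
proof -
  have t: "signed_perm n \<tau>" "card (neg n \<tau>) = r" "1 \<in> neg n \<tau>" and s: "\<sigma> \<in> Sym (card (neg n \<tau>))"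
    using assms by (auto simp: SP_def)
  show ?thesis
    using neg_comp_permute_set[OF t(1) s] t
      signed_perm_comp[OF t(1) signed_perm_permute_set[OF neg_subset s]]
    by (simp add: SP_def)
qed

text \<open>A strictly increasing list is determined by its set of entries, so the list of absolute
  values is increasing exactly when it is the sorted list of the \<open>neg_value\<close>s. Thus
  membership in \<open>AS n r\<close> means that \<sigma> is the identity.\<close>

lemma AS_iff:
  "\<tau> \<in> AS n r \<longleftrightarrow> \<tau> \<in> SP n r \<and> (\<forall>j\<in>{1..r}. \<tau> (neg_elem n \<tau> j) = - neg_value n \<tau> j)"
proof (cases "\<tau> \<in> SP n r")
  case True
  let ?A = "neg n \<tau>" and ?v = "\<lambda>d. \<bar>\<tau> d\<bar>"
  let ?xs = "sorted_list_of_set ?A" and ?ys = "sorted_list_of_set (?v ` ?A)"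
  have t: "signed_perm n \<tau>" "card ?A = r" using True by (auto simp: SP_def)
  have c: "card (?v ` ?A) = r" using card_image[OF signed_perm_inj_abs[OF t(1)]] t(2) by simp
  have "sorted_wrt (<) (map ?v ?xs) \<longleftrightarrow> map ?v ?xs = ?ys"
    using strict_sorted_list_of_set[of "?v ` ?A"]
    by (metis strict_sorted_equal set_map set_sorted_list_of_set finite_neg finite_imageI)
  also have "\<dots> \<longleftrightarrow> (\<forall>i<r. \<bar>\<tau> (?xs ! i)\<bar> = ?ys ! i)"
    using t c by (auto simp: list_eq_iff_nth_eq)
  also have "\<dots> \<longleftrightarrow> (\<forall>j\<in>{1..r}. \<bar>\<tau> (neg_elem n \<tau> j)\<bar> = neg_value n \<tau> j)"
    unfolding neg_elem_def neg_value_def nth_smallest_def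
    by (auto simp: Ball_def) (metis Suc_le_eq Suc_le_mono diff_Suc_1 le0 One_nat_def)
  also have "\<dots> \<longleftrightarrow> (\<forall>j\<in>{1..r}. \<tau> (neg_elem n \<tau> j) = - neg_value n \<tau> j)"
  proof (rule ball_cong[OF refl])
    fix j assume "j \<in> {1..r}"
    then have "neg_elem n \<tau> j \<in> ?A"
      using bij_betw_apply[OF bij_betw_neg_elem[OF t(1)]] t(2) by simp
    then show "(\<bar>\<tau> (neg_elem n \<tau> j)\<bar> = neg_value n \<tau> j) = (\<tau> (neg_elem n \<tau> j) = - neg_value n \<tau> j)"
      by (auto simp: neg_def)
  qed
  finally show ?thesis using True by (simp add: AS_def)
qed (simp add: AS_def)

lemma rho_tau_in_AS:
  assumes "\<nu> \<in> SP n r"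
  shows "rho_tau n r \<nu> \<in> AS n r"
    and "neg n (rho_tau n r \<nu>) = neg n \<nu>"
    and "(\<lambda>a. \<bar>rho_tau n r \<nu> a\<bar>) ` neg n \<nu> = (\<lambda>a. \<bar>\<nu> a\<bar>) ` neg n \<nu>"
proof -
  have v: "signed_perm n \<nu>" "card (neg n \<nu>) = r" using assms by (auto simp: SP_def)
  have i: "inv (rho_sigma n r \<nu>) \<in> Sym r"
    using rho_sigma_in_Sym[OF v] by (simp add: Sym_def permutes_inv)
  then have i': "inv (rho_sigma n r \<nu>) \<in> Sym (card (neg n \<nu>))" using v by simp
  note eq = rho_tau_eq_comp[OF v]
  show "neg n (rho_tau n r \<nu>) = neg n \<nu>"
    unfolding eq by (rule neg_comp_permute_set[OF v(1) i'])
  show "(\<lambda>a. \<bar>rho_tau n r \<nu> a\<bar>) ` neg n \<nu> = (\<lambda>a. \<bar>\<nu> a\<bar>) ` neg n \<nu>"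
    unfolding eq by (rule abs_image_comp_permute_set[OF i'])
  have "rho_tau n r \<nu> \<in> SP n r"
    unfolding eq by (rule SP_comp_permute_set[OF assms i])
  moreover have "neg_elem n (rho_tau n r \<nu>) = neg_elem n \<nu>" "neg_value n (rho_tau n r \<nu>) = neg_value n \<nu>"
    unfolding eq by (rule neg_elem_value_comp[OF v(1) i'])+
  ultimately show "rho_tau n r \<nu> \<in> AS n r"
    using rho_tau_neg_elem[OF v] by (simp add: AS_iff)
qed

text \<open>Since \<tau> sends each \<open>neg_elem\<close> to minus the \<open>neg_value\<close> of
  the same index, the composite sends the one of index \<open>j\<close> to minus the value of index
  \<open>\<sigma> j\<close>. The two enumerations are unchanged, so both components can be read
  off.\<close>

lemma rho_comp_permute_set:
  assumes "\<tau> \<in> AS n r" "\<sigma> \<in> Sym r"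
  shows "rho n r (\<tau> \<circ> permute_set (neg n \<tau>) \<sigma>) = (\<tau>, \<sigma>)"
proof -
  let ?\<nu> = "\<tau> \<circ> permute_set (neg n \<tau>) \<sigma>"
  have SP: "\<tau> \<in> SP n r" using assms(1) by (simp add: AS_iff)
  have t: "signed_perm n \<tau>" "card (neg n \<tau>) = r" and s: "\<sigma> \<in> Sym (card (neg n \<tau>))"
    using SP assms(2) by (auto simp: SP_def)
  have tj: "\<tau> (neg_elem n \<tau> j) = - neg_value n \<tau> j" if "j \<in> {1..r}" for j
    using that assms(1) by (simp add: AS_iff)
  have v: "signed_perm n ?\<nu>" "card (neg n ?\<nu>) = r"
    using SP_comp_permute_set[OF SP assms(2)] by (auto simp: SP_def)
  note eqs = neg_elem_value_comp[OF t(1) s] neg_comp_permute_set[OF t(1) s]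
  have "rho_sigma n r ?\<nu> = \<sigma>"
  proof (rule rho_sigma_eqI[OF v assms(2)])
    fix j assume j: "j \<in> {1..r}"
    then have "\<sigma> j \<in> {1..r}"
      using assms(2) unfolding Sym_def by (metis mem_Collect_eq permutes_in_image)
    then show "?\<nu> (neg_elem n ?\<nu> j) = - neg_value n ?\<nu> (\<sigma> j)"
      unfolding eqs using tj permute_set_nth[OF neg_subset s, of j] j t(2) by (simp add: neg_elem_def)
  qed
  moreover have "rho_tau n r ?\<nu> = \<tau>"
  proof (rule rho_tau_eqI[OF v t(1)])
    show "\<tau> (neg_elem n ?\<nu> j) = - neg_value n ?\<nu> j" if "j \<in> {1..r}" for j
      unfolding eqs using tj that .
    show "\<tau> x = ?\<nu> x" if "x \<notin> neg n ?\<nu>" "- x \<notin> neg n ?\<nu>" for x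
      using that permute_set_other[OF neg_subset s] unfolding eqs by simp
  qed
  ultimately show ?thesis by (simp add: rho_def)
qed

lemma comp_permute_set_rho:
  assumes "\<nu> \<in> SP n r"
  shows "rho_tau n r \<nu> \<circ> permute_set (neg n \<nu>) (rho_sigma n r \<nu>) = \<nu>"
proof (rule eq_on_signed_perm[where A = "neg n \<nu>"])
  have v: "signed_perm n \<nu>" "card (neg n \<nu>) = r" using assms by (auto simp: SP_def)
  have s: "rho_sigma n r \<nu> \<in> Sym (card (neg n \<nu>))" using rho_sigma_in_Sym[OF v] v by simp
  have t: "signed_perm n (rho_tau n r \<nu>)"
    using rho_tau_in_AS(1)[OF assms] by (simp add: AS_def SP_def)
  show "signed_perm n \<nu>" by fact
  show "signed_perm n (rho_tau n r \<nu> \<circ> permute_set (neg n \<nu>) (rho_sigma n r \<nu>))"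
    by (rule signed_perm_comp[OF t signed_perm_permute_set[OF neg_subset s]])
  show "(rho_tau n r \<nu> \<circ> permute_set (neg n \<nu>) (rho_sigma n r \<nu>)) (nth_smallest (neg n \<nu>) j) =
    \<nu> (nth_smallest (neg n \<nu>) j)" if j: "j \<in> {1..card (neg n \<nu>)}" for j
  proof -
    have "rho_sigma n r \<nu> j \<in> {1..r}"
      using s j v(2) unfolding Sym_def by (metis mem_Collect_eq permutes_in_image)
    then show ?thesis
      using permute_set_nth[OF neg_subset s j] rho_tau_neg_elem[OF v] apply_neg_elem[OF v, of j] j v(2)
      by (simp add: neg_elem_def)
  qed
  show "(rho_tau n r \<nu> \<circ> permute_set (neg n \<nu>) (rho_sigma n r \<nu>)) x = \<nu> x"
    if "x \<notin> neg n \<nu>" "- x \<notin> neg n \<nu>" for x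
    using permute_set_other[OF neg_subset s that] that by (simp add: rho_tau_def)
qed simp

lemma bij_betw_rho: "bij_betw (rho n r) (SP n r) (AS n r \<times> Sym r)"
proof (rule bij_betw_byWitness[where f' = "\<lambda>(\<tau>, \<sigma>). \<tau> \<circ> permute_set (neg n \<tau>) \<sigma>"])
  \<comment> \<open>The witness permutes the negative positions of \<open>rho_tau n r \<nu>\<close>,
    while \<open>comp_permute_set_rho\<close> permutes those of \<nu>; the two sets agree.\<close>
  show "\<forall>\<nu>\<in>SP n r. (case rho n r \<nu> of (\<tau>, \<sigma>) \<Rightarrow> \<tau> \<circ> permute_set (neg n \<tau>) \<sigma>) = \<nu>"
    using comp_permute_set_rho rho_tau_in_AS(2) by (simp add: rho_def)
  show "\<forall>p\<in>AS n r \<times> Sym r. rho n r (case p of (\<tau>, \<sigma>) \<Rightarrow> \<tau> \<circ> permute_set (neg n \<tau>) \<sigma>) = p"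
    using rho_comp_permute_set by (auto simp del: o_apply)
  show "rho n r ` SP n r \<subseteq> AS n r \<times> Sym r"
    using rho_tau_in_AS(1) rho_sigma_in_Sym by (auto simp: rho_def SP_def)
  show "(\<lambda>(\<tau>, \<sigma>). \<tau> \<circ> permute_set (neg n \<tau>) \<sigma>) ` (AS n r \<times> Sym r) \<subseteq> SP n r"
    using SP_comp_permute_set by (auto simp: AS_def)
qed

subsection \<open>Crossings\<close>

text \<open>A numerical key that realises the order \<open><\<^sub>\<tau>\<close>: the parity breaks ties in favour of
  the index \<open>i\<close> with \<open>i \<le> \<bar>\<tau> i\<bar>\<close>.\<close>

definition neg_key :: "(int \<Rightarrow> int) \<Rightarrow> int \<Rightarrow> int" where
  "neg_key \<tau> i = 2 * min i \<bar>\<tau> i\<bar> + (if i \<le> \<bar>\<tau> i\<bar> then 0 else 1)"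

lemma neg_less_iff_key: "neg_less \<tau> i j \<longleftrightarrow> neg_key \<tau> i < neg_key \<tau> j"
proof -
  \<comment> \<open>\<open>u\<close> and \<open>v\<close> stand for
    \<open>\<bar>\<tau> i\<bar>\<close> and \<open>\<bar>\<tau> j\<bar>\<close>. The premise keeps
    what is needed of their origin: for \<open>i = j\<close> the keys must coincide. The rest is
    linear arithmetic.\<close>
  have "(i \<noteq> j \<and> (min i u < min j v \<or> min i u = i \<and> i = v \<and> v = min j v)) \<longleftrightarrow>
    2 * min i u + (if i \<le> u then 0 else 1) < 2 * min j v + (if j \<le> v then 0 else 1)"
    if "i = j \<longrightarrow> u = v" for u v :: int
    using that unfolding min_def by (cases "i \<le> u"; cases "j \<le> v") (simp; linarith)+
  from this[of "\<bar>\<tau> i\<bar>" "\<bar>\<tau> j\<bar>"] show ?thesis by (simp add: neg_less_def neg_key_def)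
qed

text \<open>Equal keys have equal parity, so both minima are attained by the positions or both by
  the absolute values; in either case the positions agree. Hence \<open>neg_less \<tau>\<close> is
  total on \<open>neg n \<tau>\<close>.\<close>

lemma inj_on_neg_key:
  assumes "signed_perm n \<tau>"
  shows "inj_on (neg_key \<tau>) (neg n \<tau>)"
proof (rule inj_onI)
  fix x y assume xy: "x \<in> neg n \<tau>" "y \<in> neg n \<tau>" and eq: "neg_key \<tau> x = neg_key \<tau> y"
  have "x = y \<or> u = v"
    if "2 * min x u + (if x \<le> u then 0 else 1) = 2 * min y v + (if y \<le> v then 0 else 1)"
    for u v :: int
    using that by (simp add: min_def split: if_splits) presburger+
  then have "x = y \<or> \<bar>\<tau> x\<bar> = \<bar>\<tau> y\<bar>" using eq unfolding neg_key_def by blast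
  then show "x = y" using inj_onD[OF signed_perm_inj_abs[OF assms] _ xy] by blast
qed

text \<open>Sorting by the injective key gives a strictly increasing list, and only one list has
  that set and that order. This justifies the description in \<open>neg_list\<close>.\<close>

lemma neg_list_props:
  assumes "signed_perm n \<tau>"
  shows "set (neg_list n \<tau>) = neg n \<tau> \<and> sorted_wrt (neg_less \<tau>) (neg_list n \<tau>)"
proof -
  let ?A = "neg n \<tau>" and ?k = "neg_key \<tau>"
  have sorted_iff: "sorted_wrt (neg_less \<tau>) es \<longleftrightarrow> sorted_wrt (<) (map ?k es)" for es
    by (simp add: sorted_wrt_map neg_less_iff_key[abs_def])
  have "\<exists>!es. set es = ?A \<and> sorted_wrt (neg_less \<tau>) es"
  proof (rule ex_ex1I)
    let ?es = "sort_key ?k (sorted_list_of_set ?A)"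
    have "distinct (map ?k ?es)" using inj_on_neg_key[OF assms] by (simp add: distinct_map)
    then have "sorted_wrt (<) (map ?k ?es)" by (simp add: strict_sorted_iff)
    then show "\<exists>es. set es = ?A \<and> sorted_wrt (neg_less \<tau>) es"
      unfolding sorted_iff by (intro exI[of _ ?es]) simp
  next
    fix es es'
    assume e: "set es = ?A \<and> sorted_wrt (neg_less \<tau>) es" "set es' = ?A \<and> sorted_wrt (neg_less \<tau>) es'"
    then have "map ?k es = map ?k es'"
      unfolding sorted_iff by (intro strict_sorted_equal) auto
    then show "es = es'" using e inj_on_map_eq_map inj_on_neg_key[OF assms] by (metis Un_absorb)
  qed
  from theI'[OF this] show ?thesis unfolding neg_list_def .
qed

text \<open>The rank \<open>k\<close> lets arcs be indexed by the elements of
  \<open>neg n \<tau>\<close> themselves, with the order of their left endpoints decided by the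
  keys.\<close>

lemma neg_rank:
  assumes "signed_perm n \<tau>"
  obtains k where "bij_betw k (neg n \<tau>) {1..card (neg n \<tau>)}"
    and "\<And>x. x \<in> neg n \<tau> \<Longrightarrow> neg_nth n \<tau> (k x) = x"
    and "\<And>x y. \<lbrakk>x \<in> neg n \<tau>; y \<in> neg n \<tau>\<rbrakk> \<Longrightarrow> k x < k y \<longleftrightarrow> neg_key \<tau> x < neg_key \<tau> y"
proof
  let ?A = "neg n \<tau>" and ?es = "neg_list n \<tau>"
  let ?k = "inv_into {1..card ?A} (neg_nth n \<tau>)"
  have set: "set ?es = ?A" and "sorted_wrt (neg_less \<tau>) ?es"
    using neg_list_props[OF assms] by blast+
  then have sorted: "sorted_wrt (<) (map (neg_key \<tau>) ?es)"
    by (simp add: sorted_wrt_map neg_less_iff_key[abs_def])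
  then have dist: "distinct ?es" using strict_sorted_iff distinct_map by blast
  then have len: "length ?es = card ?A" using distinct_card set by metis
  have bij: "bij_betw (neg_nth n \<tau>) {1..card ?A} ?A"
    using nth_bij_betw[OF dist] unfolding set len neg_nth_def[abs_def] .
  show bij': "bij_betw ?k ?A {1..card ?A}" by (rule bij_betw_inv_into[OF bij])
  show nth: "neg_nth n \<tau> (?k x) = x" if "x \<in> ?A" for x
    by (rule bij_betw_inv_into_right[OF bij that])
  have mono: "neg_key \<tau> x < neg_key \<tau> y" if xy: "x \<in> ?A" "y \<in> ?A" and "?k x < ?k y" for x y
  proof -
    have "?k x \<in> {1..card ?A}" "?k y \<in> {1..card ?A}" using xy bij' by (auto dest: bij_betw_apply)
    then have "neg_key \<tau> (?es ! (?k x - 1)) < neg_key \<tau> (?es ! (?k y - 1))"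
      using sorted_wrt_nth_less[OF sorted, of "?k x - 1" "?k y - 1"] that(3) len by auto
    then show ?thesis using nth xy unfolding neg_nth_def by simp
  qed
  show "?k x < ?k y \<longleftrightarrow> neg_key \<tau> x < neg_key \<tau> y" if "x \<in> ?A" "y \<in> ?A" for x y
    using mono[OF that] mono[OF that(2,1)] nth[OF that(1)] nth[OF that(2)]
    by (metis linorder_neqE_nat order_less_asym)
qed

text \<open>The crossings that \<rho> preserves: \<open>P\<close> holds the arcs from positive
  points and \<open>B\<close> the right endpoints of the arcs from negative points. \<open>R\<close>
  is \<open>\<le>\<close> for upper and \<open><\<close> for lower crossings. In the second set
  \<open>a < c\<close> is automatic, so \<open>a\<close> is not recorded.\<close>

definition base_crossings ::
  "(int \<Rightarrow> int \<Rightarrow> bool) \<Rightarrow> (int \<times> int) set \<Rightarrow> int set \<Rightarrow> nat" where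
  "base_crossings R P B =
    card {((a, b), (c, d)). (a, b) \<in> P \<and> (c, d) \<in> P \<and> a < c \<and> R c b \<and> b < d} +
    card {(b, (c, d)). b \<in> B \<and> (c, d) \<in> P \<and> R c b \<and> b < d}"

text \<open>A crossing of an arc from a negative point with an arc from a positive point does not
  depend on the position of the negative point. Hence the arcs \<open>M\<close> from negative points matter
  only through the set of their right endpoints, except for crossings among themselves.\<close>

lemma card_crossings:
  fixes k :: "int \<Rightarrow> nat" and f :: "int \<Rightarrow> int"
  assumes "finite P" "finite A" and P: "\<And>a b. (a, b) \<in> P \<Longrightarrow> 0 < a"
    and f: "inj_on f A" "\<And>x. x \<in> A \<Longrightarrow> 0 < f x"
    and R: "\<And>c b. c \<le> 0 \<Longrightarrow> 0 < b \<Longrightarrow> R c b"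
    and M: "M = (\<lambda>x. (- int (k x), f x)) ` A"
  shows "card {((a, b), (c, d)). (a, b) \<in> P \<union> M \<and> (c, d) \<in> P \<union> M \<and> a < c \<and> R c b \<and> b < d} =
    base_crossings R P (f ` A) + card {(x, y). x \<in> A \<and> y \<in> A \<and> k y < k x \<and> f x < f y}"
    (is "card ?X = _ + card ?S3")
proof -
  let ?S1 = "{((a, b), (c, d)). (a, b) \<in> P \<and> (c, d) \<in> P \<and> a < c \<and> R c b \<and> b < d}"
  let ?S2 = "{(b, (c, d)). b \<in> f ` A \<and> (c, d) \<in> P \<and> R c b \<and> b < d}"
  \<comment> \<open>\<open>?g2\<close> restores the arc from a negative point out of its right
    endpoint, which is possible because \<open>f\<close> is injective on \<open>A\<close>.\<close>
  let ?g2 = "\<lambda>(b, q). ((- int (k (inv_into A f b)), b), q)"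
  let ?g3 = "\<lambda>(x, y). ((- int (k x), f x), (- int (k y), f y))"
  have inv: "inv_into A f (f x) = x" if "x \<in> A" for x using f(1) that by simp
  have fin: "finite ?S1" "finite ?S2" "finite ?S3"
    by (rule finite_subset[of _ "P \<times> P"] finite_subset[of _ "f ` A \<times> P"]
        finite_subset[of _ "A \<times> A"]; use assms(1,2) in auto)+
  have c2: "card (?g2 ` ?S2) = card ?S2"
    by (rule card_image) (auto simp: inj_on_def)
  have c3: "card (?g3 ` ?S3) = card ?S3"
    by (rule card_image) (use f(1) in \<open>auto simp: inj_on_def\<close>)
  have X: "?X = (?S1 \<union> ?g2 ` ?S2) \<union> ?g3 ` ?S3"
  proof (rule set_eqI, rule iffI)
    fix z assume "z \<in> ?X"
    then obtain a b c d where z: "z = ((a, b), (c, d))" and ab: "(a, b) \<in> P \<union> M"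
      and cd: "(c, d) \<in> P \<union> M" and less: "a < c" "R c b" "b < d" by auto
    show "z \<in> (?S1 \<union> ?g2 ` ?S2) \<union> ?g3 ` ?S3"
    proof (cases "(a, b) \<in> P")
      case True
      \<comment> \<open>The second arc starts to the right of a positive point, so it cannot start
        at a negative one.\<close>
      then have "(c, d) \<in> P" using cd less(1) P[OF True] by (auto simp: M)
      then show ?thesis using True less z by blast
    next
      case False
      then obtain x where x: "x \<in> A" "a = - int (k x)" "b = f x" using ab by (auto simp: M)
      show ?thesis
      proof (cases "(c, d) \<in> P")
        case True
        then have "(b, (c, d)) \<in> ?S2" using x less by blast
        moreover have "z = ?g2 (b, (c, d))" using x inv z by simp
        ultimately show ?thesis by blast
      next
        case False
        then obtain y where y: "y \<in> A" "c = - int (k y)" "d = f y" using cd by (auto simp: M)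
        then have "(x, y) \<in> ?S3" using x less by simp
        moreover have "z = ?g3 (x, y)" using x y z by simp
        ultimately show ?thesis by blast
      qed
    qed
  next
    fix z assume "z \<in> (?S1 \<union> ?g2 ` ?S2) \<union> ?g3 ` ?S3"
    then consider "z \<in> ?S1" | "z \<in> ?g2 ` ?S2" | "z \<in> ?g3 ` ?S3" by blast
    then show "z \<in> ?X"
    proof cases
      case 2
      then obtain x c d where "x \<in> A" "(c, d) \<in> P" "R c (f x)" "f x < d"
        and "z = ((- int (k x), f x), (c, d))" using inv by auto
      moreover from this have "- int (k x) < c" using P[of c d] by simp
      ultimately show ?thesis by (auto simp: M)
    next
      case 3
      \<comment> \<open>Here \<open>c \<le> 0 < b\<close>, so the condition \<open>R c b\<close>
        holds by itself.\<close>
      then show ?thesis using f(2) R by (auto simp: M)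
    qed auto
  qed
  \<comment> \<open>The signs of the two left endpoints separate the three families.\<close>
  have "card ?X = card (?S1 \<union> ?g2 ` ?S2) + card (?g3 ` ?S3)"
    unfolding X by (rule card_Un_disjoint) (use fin in \<open>auto dest: P\<close>)
  also have "card (?S1 \<union> ?g2 ` ?S2) = card ?S1 + card (?g2 ` ?S2)"
    by (rule card_Un_disjoint) (use fin in \<open>auto dest: P\<close>)
  finally show ?thesis by (simp only: c2 c3 base_crossings_def)
qed

section \<open>Crossings as a preserved part plus inversions\<close>

definition pos_upper_arcs :: "nat \<Rightarrow> (int \<Rightarrow> int) \<Rightarrow> (int \<times> int) set" where
  "pos_upper_arcs n \<tau> = {(i, \<tau> i) | i. i \<in> {1..int n} \<and> \<tau> i \<ge> i}"

definition pos_lower_arcs :: "nat \<Rightarrow> (int \<Rightarrow> int) \<Rightarrow> (int \<times> int) set" where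
  "pos_lower_arcs n \<tau> = {(\<tau> i, i) | i. i \<in> {1..int n} \<and> 0 < \<tau> i \<and> \<tau> i < i}"

definition neg_inversions :: "nat \<Rightarrow> (int \<Rightarrow> int) \<Rightarrow> (int \<times> int) set" where
  "neg_inversions n \<tau> = {(x, y). x \<in> neg n \<tau> \<and> y \<in> neg n \<tau> \<and> x < y \<and> \<bar>\<tau> y\<bar> < \<bar>\<tau> x\<bar>}"

text \<open>A pair \<open>x < y\<close> in \<open>neg \<tau>\<close> with \<open>\<bar>\<tau> x\<bar> < \<bar>\<tau> y\<bar>\<close> satisfies \<open>x <\<^sub>\<tau> y\<close> and gives no crossing;
  an inverted pair gives an upper crossing if \<open>x <\<^sub>\<tau> y\<close> and a lower one if \<open>y <\<^sub>\<tau> x\<close>.\<close>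

lemma cro_eq:
  assumes "signed_perm n \<tau>"
  shows "cro n \<tau> = base_crossings (\<le>) (pos_upper_arcs n \<tau>) ((\<lambda>a. \<bar>\<tau> a\<bar>) ` neg n \<tau>)
    + base_crossings (<) (pos_lower_arcs n \<tau>) (neg n \<tau>) + card (neg_inversions n \<tau>)"
proof -
  let ?A = "neg n \<tau>" and ?k = "neg_key \<tau>" and ?v = "\<lambda>x. \<bar>\<tau> x\<bar>"
  obtain k where k: "bij_betw k ?A {1..card ?A}"
    and nth: "\<And>x. x \<in> ?A \<Longrightarrow> neg_nth n \<tau> (k x) = x"
    and less: "\<And>x y. \<lbrakk>x \<in> ?A; y \<in> ?A\<rbrakk> \<Longrightarrow> k x < k y \<longleftrightarrow> ?k x < ?k y"
    using neg_rank[OF assms] by blast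
  have range: "{g j | j. j \<in> {1..card ?A}} = (\<lambda>x. g (k x)) ` ?A" for g :: "nat \<Rightarrow> int \<times> int"
    unfolding image_image[symmetric, of g k] bij_betw_imp_surj_on[OF k] by (rule Setcompr_eq_image)
  have up: "upper_arcs n \<tau> = pos_upper_arcs n \<tau> \<union> (\<lambda>x. (- int (k x), ?v x)) ` ?A"
    unfolding upper_arcs_def pos_upper_arcs_def range by (intro arg_cong2[of _ _ _ _ "(\<union>)"]) (auto simp: nth)
  have low: "lower_arcs n \<tau> = pos_lower_arcs n \<tau> \<union> (\<lambda>x. (- int (k x), x)) ` ?A"
    unfolding lower_arcs_def pos_lower_arcs_def range by (intro arg_cong2[of _ _ _ _ "(\<union>)"]) (auto simp: nth)
  have "finite (pos_upper_arcs n \<tau>)" "finite (pos_lower_arcs n \<tau>)"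
    unfolding pos_upper_arcs_def pos_lower_arcs_def
    by (rule finite_surj[where A = "{1..int n}" and f = "\<lambda>i. (i, \<tau> i)"]
        finite_surj[where A = "{1..int n}" and f = "\<lambda>i. (\<tau> i, i)"]; auto)+
  note fin = this
  have U: "card (upper_crossings n \<tau>) = base_crossings (\<le>) (pos_upper_arcs n \<tau>) (?v ` ?A)
    + card {(x, y). x \<in> ?A \<and> y \<in> ?A \<and> k y < k x \<and> ?v x < ?v y}"
    unfolding upper_crossings_def up
    by (rule card_crossings[OF fin(1) finite_neg _ signed_perm_inj_abs[OF assms] _ _ refl])
       (auto simp: pos_upper_arcs_def neg_def)
  \<comment> \<open>The lower arc of \<open>x\<close> ends at \<open>x\<close> itself, so
    \<open>f\<close> is the identity.\<close>
  have "card (lower_crossings n \<tau>) = base_crossings (<) (pos_lower_arcs n \<tau>) ((\<lambda>x. x) ` ?A)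
    + card {(x, y). x \<in> ?A \<and> y \<in> ?A \<and> k y < k x \<and> x < y}"
    unfolding lower_crossings_def low
    by (rule card_crossings[OF fin(2) finite_neg _ _ _ _ refl])
       (auto simp: pos_lower_arcs_def neg_def)
  then have L: "card (lower_crossings n \<tau>) = base_crossings (<) (pos_lower_arcs n \<tau>) ?A
    + card {(x, y). x \<in> ?A \<and> y \<in> ?A \<and> k y < k x \<and> x < y}" by simp
  have concordant: "?k x < ?k y" if "x < y" "?v x < ?v y" for x y
    using that unfolding neg_key_def min_def by simp
  have inj: "?v x \<noteq> ?v y" if "x \<in> ?A" "y \<in> ?A" "x \<noteq> y" for x y
    using inj_onD[OF signed_perm_inj_abs[OF assms]] that by blast
  have key: "?k x \<noteq> ?k y" if "x \<in> ?A" "y \<in> ?A" "x \<noteq> y" for x y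
    using inj_onD[OF inj_on_neg_key[OF assms]] that by blast
  let ?I = "neg_inversions n \<tau>"
  let ?I1 = "{(x, y) \<in> ?I. ?k x < ?k y}" and ?I2 = "{(x, y) \<in> ?I. ?k y < ?k x}"
  \<comment> \<open>By \<open>concordant\<close>, \<open>k y < k x\<close> and
    \<open>?v x < ?v y\<close> force \<open>y < x\<close>. The crossing thus lists the larger
    position first, whence the swap.\<close>
  have "{(x, y). x \<in> ?A \<and> y \<in> ?A \<and> k y < k x \<and> ?v x < ?v y} = prod.swap ` ?I1"
  proof (rule set_eqI, clarify)
    fix x y
    have "(x, y) \<in> prod.swap ` ?I1 \<longleftrightarrow> (y, x) \<in> ?I1" by (auto simp: image_iff)
    also have "\<dots> \<longleftrightarrow> x \<in> ?A \<and> y \<in> ?A \<and> k y < k x \<and> ?v x < ?v y"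
      using concordant[of x y] less[of y x] unfolding neg_inversions_def
      by (auto simp: not_less) (metis linorder_neqE_linordered_idom order_less_asym order_less_irrefl)
    finally show "(x, y) \<in> {(x, y). x \<in> ?A \<and> y \<in> ?A \<and> k y < k x \<and> ?v x < ?v y}
      \<longleftrightarrow> (x, y) \<in> prod.swap ` ?I1" by simp
  qed
  then have c1: "card {(x, y). x \<in> ?A \<and> y \<in> ?A \<and> k y < k x \<and> ?v x < ?v y} = card ?I1"
    by (simp add: card_image)
  \<comment> \<open>Here \<open>k y < k x\<close> and \<open>x < y\<close> exclude
    \<open>?v x < ?v y\<close>, and injectivity of the absolute values excludes equality.\<close>
  have c2: "{(x, y). x \<in> ?A \<and> y \<in> ?A \<and> k y < k x \<and> x < y} = ?I2"
  proof (rule set_eqI, clarify)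
    fix x y
    show "(x, y) \<in> {(x, y). x \<in> ?A \<and> y \<in> ?A \<and> k y < k x \<and> x < y} \<longleftrightarrow> (x, y) \<in> ?I2"
      using concordant[of x y] less[of y x] inj[of x y] unfolding neg_inversions_def
      by (auto simp: neq_iff)
  qed
  have "finite ?I"
    unfolding neg_inversions_def by (rule finite_subset[of _ "?A \<times> ?A"]) auto
  \<comment> \<open>Distinct elements have distinct keys, so every inversion is of one of the two
    kinds.\<close>
  moreover have "?I = ?I1 \<union> ?I2"
    using key unfolding neg_inversions_def by (auto simp: neq_iff)
  moreover have "?I1 \<inter> ?I2 = {}" by auto
  ultimately have "card ?I = card ?I1 + card ?I2"
    by (metis (lifting) card_Un_disjoint finite_Un)
  then show ?thesis unfolding cro_def U L c1 c2 by simp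
qed

text \<open>Both enumerations are increasing, and the absolute value at the \<open>j\<close>-th
  negative position is the \<open>neg_value\<close> of index \<open>\<sigma> j\<close>. So inverted
  pairs of positions match inverted pairs of indices.\<close>

lemma card_neg_inversions:
  assumes "signed_perm n \<nu>" "card (neg n \<nu>) = r"
  shows "card (neg_inversions n \<nu>) = inversions r (rho_sigma n r \<nu>)"
proof -
  let ?a = "neg_elem n \<nu>" and ?\<sigma> = "rho_sigma n r \<nu>"
  let ?S = "{(i, j). i \<in> {1..r} \<and> j \<in> {1..r} \<and> i < j \<and> ?\<sigma> j < ?\<sigma> i}"
  note a = bij_betw_neg_elem[OF assms(1), unfolded assms(2)]
  have abs: "\<bar>\<nu> (?a j)\<bar> = neg_value n \<nu> (?\<sigma> j)" if "j \<in> {1..r}" for j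
    using apply_neg_elem[OF assms that] bij_betw_apply[OF a that] by (simp add: neg_def)
  have \<sigma>: "?\<sigma> j \<in> {1..r}" if "j \<in> {1..r}" for j
    using rho_sigma_in_Sym[OF assms] that unfolding Sym_def
    by (metis mem_Collect_eq permutes_in_image)
  have iff: "(?a i, ?a j) \<in> neg_inversions n \<nu> \<longleftrightarrow> i < j \<and> ?\<sigma> j < ?\<sigma> i"
    if "i \<in> {1..r}" "j \<in> {1..r}" for i j
    using that \<sigma> abs bij_betw_apply[OF a] neg_elem_less_iff[OF assms(1)] neg_value_less_iff[OF assms(1)]
    by (simp add: neg_inversions_def assms(2))
  have "neg_inversions n \<nu> = map_prod ?a ?a ` ?S"
  proof (rule equalityI; rule subsetI)
    fix z assume z: "z \<in> neg_inversions n \<nu>"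
    then have "z \<in> ?a ` {1..r} \<times> ?a ` {1..r}"
      unfolding bij_betw_imp_surj_on[OF a] neg_inversions_def by auto
    then obtain i j where "i \<in> {1..r}" "j \<in> {1..r}" "z = (?a i, ?a j)" by blast
    then show "z \<in> map_prod ?a ?a ` ?S" using iff z by force
  qed (use iff in auto)
  moreover have "inj_on (map_prod ?a ?a) ?S"
    by (rule inj_on_subset[OF map_prod_inj_on[OF bij_betw_imp_inj_on[OF a] bij_betw_imp_inj_on[OF a]]])
       auto
  ultimately show ?thesis by (simp add: card_image inversions_def)
qed

lemma cro_rho:
  assumes "\<nu> \<in> SP n r"
  shows "cro n \<nu> = cro n (rho_tau n r \<nu>) + inversions r (rho_sigma n r \<nu>)"
proof -
  let ?\<tau> = "rho_tau n r \<nu>"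
  have v: "signed_perm n \<nu>" "card (neg n \<nu>) = r" using assms by (auto simp: SP_def)
  have AS: "?\<tau> \<in> AS n r" and neg: "neg n ?\<tau> = neg n \<nu>" by (rule rho_tau_in_AS[OF assms])+
  then have t: "signed_perm n ?\<tau>" "card (neg n ?\<tau>) = r" by (auto simp: AS_def SP_def)
  \<comment> \<open>By \<open>AS_iff\<close> the identity satisfies the characterisation of \<sigma>
    for \<open>?\<tau>\<close>, so \<open>?\<tau>\<close> contributes no inversions.\<close>
  have sig: "rho_sigma n r ?\<tau> = id"
    by (rule rho_sigma_eqI[OF t]) (use AS in \<open>simp_all add: AS_iff Sym_def\<close>)
  have "{(i, j). i \<in> {1..r} \<and> j \<in> {1..r} \<and> i < j \<and> id j < id i} = {}" by auto
  then have inv: "card (neg_inversions n ?\<tau>) = 0"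
    unfolding card_neg_inversions[OF t] sig inversions_def by (simp only: card.empty)
  \<comment> \<open>Arcs from positive points arise only from positive values, so they cannot tell
    two negative values apart.\<close>
  have eq: "?\<tau> i = \<nu> i \<or> ?\<tau> i < 0 \<and> \<nu> i < 0" if "i \<in> {1..int n}" for i
  proof (cases "i \<in> neg n \<nu>")
    case True
    then show ?thesis using neg unfolding neg_def by blast
  next
    case False
    moreover have "- i \<notin> neg n \<nu>" using that by (simp add: neg_def)
    ultimately show ?thesis by (simp add: rho_tau_def)
  qed
  have "pos_upper_arcs n ?\<tau> = pos_upper_arcs n \<nu>" "pos_lower_arcs n ?\<tau> = pos_lower_arcs n \<nu>"
    unfolding pos_upper_arcs_def pos_lower_arcs_def using eq by force+
  then show ?thesis
    unfolding cro_eq[OF t(1)] cro_eq[OF v(1)] card_neg_inversions[OF v] inv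
      neg rho_tau_in_AS(3)[OF assms] by simp
qed

theorem theorem6p8:
  fixes n r :: nat
  assumes "r \<ge> 1" and "n \<ge> r"
  shows "bij_betw (rho n r) (SP n r) (AS n r \<times> Sym r) \<and>
    (\<forall>\<nu>\<in>SP n r. \<forall>\<tau> \<sigma>. rho n r \<nu> = (\<tau>, \<sigma>) \<longrightarrow> cro n \<nu> = cro n \<tau> + inversions r \<sigma>)"
  using bij_betw_rho cro_rho by (simp add: rho_def)

end
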